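(* Let $G$ be a finite group acting on a finite set $\mathcal{X}$. The collection of $G$-invariant probability measures on $\mathcal{X}$ is a convex set whose extreme points are the measures $e_{G(x)}$, indexed by the orbits $G(x)=\{gx: g\in G\}$ of $\mathcal{X}$, where $e_{G(x)}$ places weight $1/|G(x)|$ on each member of $G(x)$ and $0$ everywhere else.
   Context: A probability measure $P$ on $\mathcal{X}$ is $G$-invariant if $P(\{gx\})=P(\{x\})$ for all $g\in G$ and $x\in\mathcal{X}$. *)

theory Defs
  imports
    "HOL-Probability.Probability"
    "HOL-Algebra.Group_Action"
    "HOL-Library.Function_Algebras"
begin

text \<open>
  Measures do not form a vector space, so a finite measure \<open>P\<close> on \<open>X\<close> is identified with its
  real-valued set function \<open>measure P\<close>. Convexity and extreme points then refer to the pointwise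
  vector space structure on set functions: \<open>(s P + t Q)(A) = s P(A) + t Q(A)\<close>.
\<close>

instantiation "fun" :: (type, real_vector) real_vector
begin

definition scaleR_fun :: "real \<Rightarrow> ('a \<Rightarrow> 'b) \<Rightarrow> 'a \<Rightarrow> 'b"
  where "scaleR_fun c f = (\<lambda>x. c *\<^sub>R f x)"

instance
  by standard
    (auto simp: scaleR_fun_def fun_eq_iff scaleR_add_right scaleR_add_left)

end

definition invariant_prob_measures ::
    "('g, 'm) monoid_scheme \<Rightarrow> 'x set \<Rightarrow> ('g \<Rightarrow> 'x \<Rightarrow> 'x) \<Rightarrow> 'x measure set"
  where "invariant_prob_measures G X \<phi> =
    {P. prob_space P \<and> space P = X \<and> sets P = Pow X \<and>
        (\<forall>g \<in> carrier G. \<forall>x \<in> X. measure P {\<phi> g x} = measure P {x})}"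

definition orbit_measure :: "'x set \<Rightarrow> 'x set \<Rightarrow> 'x measure"
  where "orbit_measure X S =
    point_measure X (\<lambda>y. ennreal (if y \<in> S then 1 / real (card S) else 0))"

text \<open>Nothing is lost by passing from measures to set functions:\<close>

lemma inj_on_measure_invariant_prob_measures:
  "inj_on measure (invariant_prob_measures G X \<phi>)"
proof (rule inj_onI)
  fix P Q
  assume P: "P \<in> invariant_prob_measures G X \<phi>"
    and Q: "Q \<in> invariant_prob_measures G X \<phi>"
    and eq: "measure P = measure Q"
  interpret P: prob_space P using P by (simp add: invariant_prob_measures_def)
  interpret Q: prob_space Q using Q by (simp add: invariant_prob_measures_def)
  show "P = Q"
  proof (rule measure_eqI)
    show "sets P = sets Q"
      using P Q by (simp add: invariant_prob_measures_def)
    show "emeasure P A = emeasure Q A" for A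
      by (simp add: P.emeasure_eq_measure Q.emeasure_eq_measure eq)
  qed
qed

end

theory Submission
  imports Defs
begin

text \<open>
  An invariant probability measure \<open>P\<close> is constant on each orbit \<open>S\<close>, hence
  \<open>P = (\<Sum>S. P(S) e\<^sub>S)\<close>, a convex combination. So the invariant measures form the convex hull
  of the \<open>e\<^sub>S\<close>, and every extreme point is some \<open>e\<^sub>S\<close>. Conversely, if \<open>e\<^sub>S\<close> lies strictly
  between two invariant measures, both vanish off \<open>S\<close> and are constant on \<open>S\<close>, so both equal
  \<open>e\<^sub>S\<close>.
\<close>

section \<open>Invariant measures as set functions\<close>

lemma sum_fun_apply: "(\<Sum>i\<in>I. f i) x = (\<Sum>i\<in>I. f i x)"
  for f :: "'i \<Rightarrow> 'a \<Rightarrow> 'b::comm_monoid_add"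
  by (induction I rule: infinite_finite_induct) auto

text \<open>For finite \<open>X\<close> this is the image of \<open>invariant_prob_measures\<close>
  under \<open>measure\<close>, described by finite sums alone. The value 0 on sets not contained in
  \<open>X\<close> copies the default that \<open>measure\<close> gives to non-measurable
  sets.\<close>

definition invariant_set_functions ::
    "('g, 'm) monoid_scheme \<Rightarrow> 'x set \<Rightarrow> ('g \<Rightarrow> 'x \<Rightarrow> 'x) \<Rightarrow> ('x set \<Rightarrow> real) set"
  where "invariant_set_functions G X \<phi> =
    {m. (\<forall>A. m A = (if A \<subseteq> X then \<Sum>x\<in>A. m {x} else 0)) \<and> (\<forall>A. 0 \<le> m A) \<and> m X = 1 \<and>
        (\<forall>g \<in> carrier G. \<forall>x \<in> X. m {\<phi> g x} = m {x})}"

lemma invariant_set_functionsI: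
  assumes "\<And>A. m A = (if A \<subseteq> X then \<Sum>x\<in>A. m {x} else 0)" "\<And>A. 0 \<le> m A" "m X = 1"
    and "\<And>g x. g \<in> carrier G \<Longrightarrow> x \<in> X \<Longrightarrow> m {\<phi> g x} = m {x}"
  shows "m \<in> invariant_set_functions G X \<phi>"
  unfolding invariant_set_functions_def using assms by blast

lemma invariant_set_functionsD:
  assumes "m \<in> invariant_set_functions G X \<phi>"
  shows "m A = (if A \<subseteq> X then \<Sum>x\<in>A. m {x} else 0)" "0 \<le> m A" "m X = 1"
    and "g \<in> carrier G \<Longrightarrow> x \<in> X \<Longrightarrow> m {\<phi> g x} = m {x}"
  using assms unfolding invariant_set_functions_def by blast+

lemma invariant_set_functions_eqI:
  assumes "m \<in> invariant_set_functions G X \<phi>" "m' \<in> invariant_set_functions G X \<phi>"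
    and "\<And>x. x \<in> X \<Longrightarrow> m {x} = m' {x}"
  shows "m = m'"
proof
  fix A
  have "m A = (if A \<subseteq> X then \<Sum>x\<in>A. m {x} else 0)"
    using assms(1) by (rule invariant_set_functionsD)
  also have "\<dots> = (if A \<subseteq> X then \<Sum>x\<in>A. m' {x} else 0)"
    using assms(3) by (auto intro!: sum.cong)
  also have "\<dots> = m' A"
    using assms(2) by (rule invariant_set_functionsD(1)[symmetric])
  finally show "m A = m' A" .
qed

text \<open>On a finite space whose measurable sets are all subsets, finite additivity reduces a
  measure to its singleton weights. Conversely, nonnegative weights of total 1 are realised by a
  \<open>point_measure\<close>.\<close>

lemma measure_invariant_prob_measures:
  assumes "finite X"
  shows "measure ` invariant_prob_measures G X \<phi> = invariant_set_functions G X \<phi>"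
proof
  show "measure ` invariant_prob_measures G X \<phi> \<subseteq> invariant_set_functions G X \<phi>"
  proof
    fix m assume "m \<in> measure ` invariant_prob_measures G X \<phi>"
    then obtain P where m: "m = measure P" and P: "P \<in> invariant_prob_measures G X \<phi>"
      by blast
    interpret prob_space P using P by (simp add: invariant_prob_measures_def)
    have X: "space P = X" "sets P = Pow X"
      using P by (auto simp: invariant_prob_measures_def)
    show "m \<in> invariant_set_functions G X \<phi>"
    proof (rule invariant_set_functionsI)
      show "m A = (if A \<subseteq> X then \<Sum>x\<in>A. m {x} else 0)" for A
      proof (cases "A \<subseteq> X")
        case True
        then have "finite A" using assms by (rule finite_subset)
        then have "prob A = (\<Sum>x\<in>A. prob {x})"
          by (rule finite_measure_eq_sum_singleton) (use True X in auto)
        with True m show ?thesis by simp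
      next
        case False
        \<comment> \<open>Such an \<open>A\<close> is not in \<open>sets P\<close>, so
          \<open>measure\<close> returns its default 0.\<close>
        with X m show ?thesis by (simp add: measure_notin_sets)
      qed
    next
      show "m X = 1" using prob_space X m by simp
    qed (use P m in \<open>auto simp: invariant_prob_measures_def\<close>)
  qed
next
  show "invariant_set_functions G X \<phi> \<subseteq> measure ` invariant_prob_measures G X \<phi>"
  proof
    fix m assume m: "m \<in> invariant_set_functions G X \<phi>"
    define P where "P = point_measure X (\<lambda>x. ennreal (m {x}))"
    have mP: "measure P = m"
    proof
      fix A
      have "measure P A = (if A \<subseteq> X then \<Sum>x\<in>A. m {x} else 0)"
        unfolding P_def using assms invariant_set_functionsD(2)[OF m]
        by (intro measure_point_measure_finite_if)
      also have "\<dots> = m A"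
        using m by (rule invariant_set_functionsD(1)[symmetric])
      finally show "measure P A = m A" .
    qed
    have P: "space P = X" "sets P = Pow X"
      by (simp_all add: P_def space_point_measure sets_point_measure)
    have "emeasure P X = ennreal (\<Sum>x\<in>X. m {x})"
      unfolding P_def using assms invariant_set_functionsD(2)[OF m]
      by (simp add: emeasure_point_measure_finite)
    also have "(\<Sum>x\<in>X. m {x}) = m X"
      using invariant_set_functionsD(1)[OF m, of X] by simp
    also have "m X = 1"
      using m by (rule invariant_set_functionsD(3))
    finally have "prob_space P" using P by (intro prob_spaceI) simp
    then have "P \<in> invariant_prob_measures G X \<phi>"
      using P mP invariant_set_functionsD(4)[OF m] by (simp add: invariant_prob_measures_def)
    then show "m \<in> measure ` invariant_prob_measures G X \<phi>"
      using mP by blast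
  qed
qed

text \<open>Each defining condition is a linear equation, a sign condition or the normalisation at
  \<open>X\<close>, and all three kinds survive convex combinations.\<close>

lemma convex_invariant_set_functions: "convex (invariant_set_functions G X \<phi>)"
proof (rule convexI)
  fix a b and u v :: real
  assume a: "a \<in> invariant_set_functions G X \<phi>" and b: "b \<in> invariant_set_functions G X \<phi>"
    and uv: "0 \<le> u" "0 \<le> v" "u + v = 1"
  note aD = invariant_set_functionsD[OF a] and bD = invariant_set_functionsD[OF b]
  show "u *\<^sub>R a + v *\<^sub>R b \<in> invariant_set_functions G X \<phi>"
  proof (rule invariant_set_functionsI)
    show "(u *\<^sub>R a + v *\<^sub>R b) A =
        (if A \<subseteq> X then \<Sum>x\<in>A. (u *\<^sub>R a + v *\<^sub>R b) {x} else 0)" for A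
      unfolding scaleR_fun_def plus_fun_apply aD(1)[of A] bD(1)[of A]
      by (auto simp: sum.distrib sum_distrib_left)
  qed (use uv in \<open>simp_all add: scaleR_fun_def aD(2-4) bD(2-4)\<close>)
qed

lemma measure_orbit_measure:
  assumes "finite X"
  shows "measure (orbit_measure X S) A =
    (if A \<subseteq> X then \<Sum>y\<in>A. if y \<in> S then 1 / real (card S) else 0 else 0)"
  unfolding orbit_measure_def using assms by (intro measure_point_measure_finite_if) auto

section \<open>Orbits and their uniform measures\<close>

context group_action
begin

lemma orbits_nonempty_subset: "S \<in> orbits G E \<phi> \<Longrightarrow> S \<noteq> {} \<and> S \<subseteq> E"
  using orbit_refl element_image by (fastforce simp: orbits_def orbit_def)

lemma orbits_eqI:
  assumes "S \<in> orbits G E \<phi>" "T \<in> orbits G E \<phi>" "x \<in> S" "x \<in> T"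
  shows "S = T"
proof -
  have "x \<in> E" using assms orbits_nonempty_subset by blast
  then show ?thesis
    using orbit_partition assms unfolding partition_def by blast
qed

text \<open>Both points lie in the orbit of \<open>x\<close>, and distinct orbits are disjoint. This
  gives the invariance of the orbit measures.\<close>

lemma in_orbits_apply_iff:
  assumes "S \<in> orbits G E \<phi>" "g \<in> carrier G" "x \<in> E"
  shows "\<phi> g x \<in> S \<longleftrightarrow> x \<in> S"
proof -
  have "orbit G \<phi> x \<in> orbits G E \<phi>" "\<phi> g x \<in> orbit G \<phi> x" "x \<in> orbit G \<phi> x"
    using assms orbit_refl by (auto simp: orbits_def orbit_def)
  then show ?thesis using assms(1) orbits_eqI by metis
qed

text \<open>Every point of the orbit is \<open>\<phi> g z\<close> for one representative
  \<open>z\<close>, so invariance compares all weights with that of \<open>z\<close>.\<close>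

lemma invariant_set_functions_constant:
  assumes "m \<in> invariant_set_functions G E \<phi>" "S \<in> orbits G E \<phi>" "x \<in> S" "y \<in> S"
  shows "m {x} = m {y}"
proof -
  obtain z where z: "z \<in> E" "S = orbit G \<phi> z"
    using assms(2) by (auto simp: orbits_def)
  have "m {w} = m {z}" if "w \<in> S" for w
    using that z invariant_set_functionsD(4)[OF assms(1)] by (auto simp: orbit_def)
  then show ?thesis using assms by simp
qed

lemma measure_orbit_measure_in_invariant_set_functions:
  assumes "finite E" "S \<in> orbits G E \<phi>"
  shows "measure (orbit_measure E S) \<in> invariant_set_functions G E \<phi>"
proof -
  have S: "S \<noteq> {}" "S \<subseteq> E" using orbits_nonempty_subset assms by auto
  then have "finite S" using assms finite_subset by blast
  let ?e = "measure (orbit_measure E S)"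
  show ?thesis
  proof (rule invariant_set_functionsI)
    show "?e A = (if A \<subseteq> E then \<Sum>x\<in>A. ?e {x} else 0)" for A
      by (auto simp: measure_orbit_measure assms intro!: sum.cong)
    show "?e E = 1"
      using S \<open>finite S\<close> by (simp add: measure_orbit_measure assms sum.If_cases Int_absorb1)
    show "?e {\<phi> g x} = ?e {x}" if "g \<in> carrier G" "x \<in> E" for g x
      using that assms by (simp add: measure_orbit_measure in_orbits_apply_iff element_image)
  qed simp
qed

section \<open>Decomposition over the orbits\<close>

lemma invariant_set_functions_sum:
  assumes m: "m \<in> invariant_set_functions G E \<phi>" and S: "S \<in> orbits G E \<phi>" and x: "x \<in> S"
  shows "m S = real (card S) * m {x}"
proof -
  have "m S = (\<Sum>y\<in>S. m {y})"
    using invariant_set_functionsD(1)[OF m, of S] orbits_nonempty_subset[OF S] by simp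
  also have "\<dots> = (\<Sum>y\<in>S. m {x})"
    using invariant_set_functions_constant[OF m S _ x] by (rule sum.cong[OF refl])
  finally show ?thesis by simp
qed

text \<open>The identity is checked on singletons, where constancy on orbits gives the weight
  \<open>m T / card T\<close>, and is carried to all sets by additivity.\<close>

lemma invariant_set_functions_eq_sum:
  assumes fin: "finite E" and m: "m \<in> invariant_set_functions G E \<phi>"
  shows "m = (\<Sum>S\<in>orbits G E \<phi>. m S *\<^sub>R measure (orbit_measure E S))"
    and "(\<Sum>S\<in>orbits G E \<phi>. m S) = 1"
proof -
  let ?O = "orbits G E \<phi>"
  have finO: "finite ?O" using fin by (simp add: orbits_def)
  have single: "m {x} = (\<Sum>S\<in>?O. m S * (if x \<in> S then 1 / real (card S) else 0))" if "x \<in> E" for x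
  proof -
    obtain T where T: "T \<in> ?O" "x \<in> T"
      using \<open>x \<in> E\<close> orbit_refl by (auto simp: orbits_def)
    have "finite T" "T \<noteq> {}"
      using T orbits_nonempty_subset finite_subset[OF _ fin] by auto
    \<comment> \<open>Orbits are disjoint, so only the orbit \<open>T\<close> through
      \<open>x\<close> contributes.\<close>
    have "(\<Sum>S\<in>?O. m S * (if x \<in> S then 1 / real (card S) else 0)) =
        (\<Sum>S\<in>?O. if S = T then m T * (1 / real (card T)) else 0)"
      using T orbits_eqI by (intro sum.cong) auto
    also have "\<dots> = m T / real (card T)"
      using T finO by simp
    also have "\<dots> = m {x}"
      using invariant_set_functions_sum[OF m T] \<open>finite T\<close> \<open>T \<noteq> {}\<close> by simp
    finally show ?thesis by simp
  qed
  show decomp: "m = (\<Sum>S\<in>?O. m S *\<^sub>R measure (orbit_measure E S))"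
  proof
    fix A
    have "m A = (if A \<subseteq> E
        then \<Sum>x\<in>A. \<Sum>S\<in>?O. m S * (if x \<in> S then 1 / real (card S) else 0) else 0)"
      by (subst invariant_set_functionsD(1)[OF m]) (auto intro!: sum.cong single)
    \<comment> \<open>For \<open>A\<close> inside \<open>E\<close> the two sums are interchanged;
      otherwise both sides are 0 by the default value.\<close>
    also have "\<dots> = (\<Sum>S\<in>?O. m S * measure (orbit_measure E S) A)"
      unfolding measure_orbit_measure[OF fin] by (auto simp: sum_distrib_left intro: sum.swap)
    also have "\<dots> = (\<Sum>S\<in>?O. m S *\<^sub>R measure (orbit_measure E S)) A"
      by (simp add: sum_fun_apply scaleR_fun_def)
    finally show "m A = (\<Sum>S\<in>?O. m S *\<^sub>R measure (orbit_measure E S)) A" .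
  qed
  \<comment> \<open>Evaluating the decomposition at \<open>E\<close>, where every orbit measure
    equals 1, shows that the coefficients add up to 1.\<close>
  have "1 = m E" using invariant_set_functionsD(3)[OF m] by simp
  also have "\<dots> = (\<Sum>S\<in>?O. m S *\<^sub>R measure (orbit_measure E S)) E"
    using decomp by (rule fun_cong)
  also have "\<dots> = (\<Sum>S\<in>?O. m S * measure (orbit_measure E S) E)"
    by (simp add: sum_fun_apply scaleR_fun_def)
  also have "\<dots> = (\<Sum>S\<in>?O. m S)"
    using invariant_set_functionsD(3)[OF measure_orbit_measure_in_invariant_set_functions[OF fin]]
    by simp
  finally show "(\<Sum>S\<in>?O. m S) = 1" by simp
qed

text \<open>In this form \<open>extreme_point_of_convex_hull\<close> applies: an extreme point of a
  hull belongs to the generating set.\<close>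

lemma invariant_set_functions_eq_hull:
  assumes fin: "finite E"
  shows "invariant_set_functions G E \<phi> =
    convex hull ((\<lambda>S. measure (orbit_measure E S)) ` orbits G E \<phi>)" (is "?M = convex hull ?B")
proof
  show "convex hull ?B \<subseteq> ?M"
    using measure_orbit_measure_in_invariant_set_functions[OF fin]
    by (intro hull_minimal convex_invariant_set_functions) auto
  show "?M \<subseteq> convex hull ?B"
  proof
    fix m assume m: "m \<in> ?M"
    have "finite (orbits G E \<phi>)" using fin by (simp add: orbits_def)
    then have "(\<Sum>S\<in>orbits G E \<phi>. m S *\<^sub>R measure (orbit_measure E S)) \<in> convex hull ?B"
      using invariant_set_functions_eq_sum(2)[OF fin m] invariant_set_functionsD(2)[OF m]
      by (intro convex_sum) (auto intro: hull_inc)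
    then show "m \<in> convex hull ?B"
      using invariant_set_functions_eq_sum(1)[OF fin m] by simp
  qed
qed

text \<open>The whole mass 1 sits on \<open>S\<close> and is spread there evenly, which fixes every
  singleton weight.\<close>

lemma eq_orbit_measureI:
  assumes fin: "finite E" and m: "m \<in> invariant_set_functions G E \<phi>" and S: "S \<in> orbits G E \<phi>"
    and off: "\<And>x. x \<in> E \<Longrightarrow> x \<notin> S \<Longrightarrow> m {x} = 0"
  shows "m = measure (orbit_measure E S)"
proof (rule invariant_set_functions_eqI[OF m])
  show "measure (orbit_measure E S) \<in> invariant_set_functions G E \<phi>"
    using fin S by (rule measure_orbit_measure_in_invariant_set_functions)
  have sub: "S \<subseteq> E" "S \<noteq> {}" using S orbits_nonempty_subset by auto
  have "1 = (\<Sum>x\<in>E. m {x})"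
    using invariant_set_functionsD(1)[OF m, of E] invariant_set_functionsD(3)[OF m] by simp
  also have "\<dots> = (\<Sum>x\<in>S. m {x})"
    using fin sub off by (intro sum.mono_neutral_right) auto
  also have "\<dots> = m S"
    using invariant_set_functionsD(1)[OF m, of S] sub by simp
  finally have "m S = 1" by simp
  moreover have "card S \<noteq> 0" using sub finite_subset[OF _ fin] by simp
  ultimately have "m {x} = 1 / real (card S)" if "x \<in> S" for x
    using invariant_set_functions_sum[OF m S that] by (simp add: field_simps)
  then show "m {x} = measure (orbit_measure E S) {x}" if "x \<in> E" for x
    using that off by (simp add: measure_orbit_measure fin)
qed

section \<open>Extreme points\<close>

lemma extreme_point_orbit_measure:
  assumes fin: "finite E" and S: "S \<in> orbits G E \<phi>"
  shows "measure (orbit_measure E S) extreme_point_of invariant_set_functions G E \<phi>"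
  unfolding extreme_point_of_def
proof (intro conjI ballI notI)
  show "measure (orbit_measure E S) \<in> invariant_set_functions G E \<phi>"
    using fin S by (rule measure_orbit_measure_in_invariant_set_functions)
  fix a b
  assume a: "a \<in> invariant_set_functions G E \<phi>" and b: "b \<in> invariant_set_functions G E \<phi>"
    and "measure (orbit_measure E S) \<in> open_segment a b"
  then obtain u where "a \<noteq> b" and u: "0 < u" "u < 1"
    and eq: "measure (orbit_measure E S) = (1 - u) *\<^sub>R a + u *\<^sub>R b"
    by (auto simp: in_segment)
  \<comment> \<open>A combination of nonnegative numbers with positive coefficients vanishes only if
    both numbers do.\<close>
  have "a {x} = 0 \<and> b {x} = 0" if "x \<in> E" "x \<notin> S" for x
  proof -
    have "(1 - u) * a {x} + u * b {x} = measure (orbit_measure E S) {x}"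
      by (simp add: eq scaleR_fun_def)
    also have "\<dots> = 0" using that by (simp add: measure_orbit_measure fin)
    finally have "(1 - u) * a {x} + u * b {x} = 0" .
    moreover have "0 \<le> a {x}" "0 \<le> b {x}"
      using invariant_set_functionsD(2) a b by blast+
    ultimately show ?thesis
      using u by (simp add: add_nonneg_eq_0_iff)
  qed
  then have "a = measure (orbit_measure E S)" "b = measure (orbit_measure E S)"
    using eq_orbit_measureI[OF fin _ S] a b by blast+
  with \<open>a \<noteq> b\<close> show False by simp
qed

text \<open>An orbit can be read off its measure as the set of points of nonzero weight; a single
  common point already forces two orbits to agree.\<close>

lemma inj_on_orbit_measure:
  assumes fin: "finite E"
  shows "inj_on (\<lambda>S. measure (orbit_measure E S)) (orbits G E \<phi>)"
proof (rule inj_onI)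
  fix S T assume S: "S \<in> orbits G E \<phi>" and T: "T \<in> orbits G E \<phi>"
    and eq: "measure (orbit_measure E S) = measure (orbit_measure E T)"
  obtain x where x: "x \<in> S" "x \<in> E" using S orbits_nonempty_subset by blast
  have "card S \<noteq> 0"
    using S x orbits_nonempty_subset[OF S] finite_subset[OF _ fin] by auto
  then have "measure (orbit_measure E S) {x} \<noteq> 0"
    using x by (simp add: measure_orbit_measure fin)
  then have "measure (orbit_measure E T) {x} \<noteq> 0" using eq by simp
  then have "x \<in> T" using x by (simp add: measure_orbit_measure fin split: if_splits)
  then show "S = T" using orbits_eqI[OF S T] x by simp
qed

end

theorem theorem5:
  fixes G :: "('g, 'm) monoid_scheme"
    and X :: "'x set"
    and \<phi> :: "'g \<Rightarrow> 'x \<Rightarrow> 'x"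
  assumes "group_action G X \<phi>"
    and "finite (carrier G)"
    and "finite X"
  shows "convex (measure ` invariant_prob_measures G X \<phi>) \<and>
    bij_betw (\<lambda>S. measure (orbit_measure X S)) (orbits G X \<phi>)
      {p. p extreme_point_of (measure ` invariant_prob_measures G X \<phi>)}"
proof -
  interpret group_action G X \<phi> by fact
  \<comment> \<open>Orbit measures are extreme by \<open>extreme_point_orbit_measure\<close>; the
    hull description supplies the reverse inclusion.\<close>
  have "(\<lambda>S. measure (orbit_measure X S)) ` orbits G X \<phi> =
      {p. p extreme_point_of invariant_set_functions G X \<phi>}"
    using extreme_point_orbit_measure[OF \<open>finite X\<close>]
      extreme_point_of_convex_hull[of _ "(\<lambda>S. measure (orbit_measure X S)) ` orbits G X \<phi>"]
      invariant_set_functions_eq_hull[OF \<open>finite X\<close>]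
    by auto
  then show ?thesis
    using inj_on_orbit_measure[OF \<open>finite X\<close>] convex_invariant_set_functions[of G X \<phi>]
    by (simp add: measure_invariant_prob_measures[OF \<open>finite X\<close>] bij_betw_def)
qed

end
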